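(* Let $G$ be a graph such that for every $\gamma_R$-function $f=(V_0,V_1,V_2)$ of $G$, the induced subgraph $G[V_2]$ has an isolated vertex. Then $\gamma_R(\mu(G))=\gamma_R(G)+2$.
   Context: All graphs are finite and simple. A Roman dominating function (RDF) of $G=(V,E)$ is a function $f:V\to\{0,1,2\}$ such that every vertex $v$ with $f(v)=0$ has a neighbor $w$ with $f(w)=2$; its weight is $\sum_v f(v)$, $\gamma_R(G)$ is the minimum weight of an RDF, and a $\gamma_R$-function is an RDF of weight $\gamma_R(G)$. Write $f=(V_0,V_1,V_2)$ with $V_i=\{v:f(v)=i\}$. The Mycielskian $\mu(G)$ of $G$ with $V(G)=\{v_1^0,\ldots,v_n^0\}$ has vertex set $\{v_j^0\}\cup\{v_j^1\}\cup\{u\}$ and edge set $E(G)\cup\{v_j^0v_{j'}^1 : v_j^0v_{j'}^0\in E(G)\}\cup\{v_j^1u: 1\leq j\leq n\}$. *)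

theory Defs
  imports Graph_Theory.Pair_Digraph Graph_Theory.Digraph_Component
begin

text \<open>
  A finite simple graph is a \<^locale>\<open>pair_graph\<close>: finitely many vertices, and a symmetric,
  irreflexive set of arcs in which each edge occurs in both orientations.
\<close>

definition roman_dominating :: "'a pair_pre_digraph \<Rightarrow> ('a \<Rightarrow> nat) \<Rightarrow> bool" where
  "roman_dominating G f \<longleftrightarrow>
     (\<forall>v \<in> pverts G. f v \<in> {0, 1, 2}) \<and>
     (\<forall>v \<in> pverts G. f v = 0 \<longrightarrow> (\<exists>w \<in> pverts G. (v, w) \<in> parcs G \<and> f w = 2))"

definition rdf_weight :: "'a pair_pre_digraph \<Rightarrow> ('a \<Rightarrow> nat) \<Rightarrow> nat" where
  "rdf_weight G f = (\<Sum>v \<in> pverts G. f v)"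

definition roman_domination_number :: "'a pair_pre_digraph \<Rightarrow> nat" where
  "roman_domination_number G = (LEAST k. \<exists>f. roman_dominating G f \<and> rdf_weight G f = k)"

text \<open>The constant function 1 is Roman dominating, so the minimum is over a nonempty set.\<close>

lemma roman_dominating_const_1: "roman_dominating G (\<lambda>_. 1)"
  by (simp add: roman_dominating_def)

lemma roman_domination_number_attained:
  "\<exists>f. roman_dominating G f \<and> rdf_weight G f = roman_domination_number G"
  unfolding roman_domination_number_def
  by (rule LeastI_ex) (use roman_dominating_const_1 in blast)

lemma roman_domination_number_le:
  "roman_dominating G f \<Longrightarrow> roman_domination_number G \<le> rdf_weight G f"
  unfolding roman_domination_number_def by (rule Least_le) blast

definition roman_min_function :: "'a pair_pre_digraph \<Rightarrow> ('a \<Rightarrow> nat) \<Rightarrow> bool" where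
  "roman_min_function G f \<longleftrightarrow>
     roman_dominating G f \<and> rdf_weight G f = roman_domination_number G"

definition rdf_class :: "'a pair_pre_digraph \<Rightarrow> ('a \<Rightarrow> nat) \<Rightarrow> nat \<Rightarrow> 'a set" where
  "rdf_class G f i = {v \<in> pverts G. f v = i}"

definition isolated_vertex :: "('a, 'b) pre_digraph \<Rightarrow> 'a \<Rightarrow> bool" where
  "isolated_vertex H v \<longleftrightarrow> v \<in> verts H \<and> in_arcs H v = {} \<and> out_arcs H v = {}"

datatype 'a mycielski_vertex = Orig 'a | Copy 'a | Apex

definition mycielskian :: "'a pair_pre_digraph \<Rightarrow> 'a mycielski_vertex pair_pre_digraph" where
  "mycielskian G =
     \<lparr> pverts = Orig ` pverts G \<union> Copy ` pverts G \<union> {Apex},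
       parcs =
         {(Orig x, Orig y) | x y. (x, y) \<in> parcs G} \<union>
         {(Orig x, Copy y) | x y. (x, y) \<in> parcs G} \<union>
         {(Copy x, Orig y) | x y. (x, y) \<in> parcs G} \<union>
         {(Copy x, Apex) | x. x \<in> pverts G} \<union>
         {(Apex, Copy x) | x. x \<in> pverts G} \<rparr>"

lemma pair_graph_mycielskian:
  assumes "pair_graph G"
  shows "pair_graph (mycielskian G)"
proof -
  interpret pair_graph G by (fact assms)
  let ?M = "mycielskian G"
  have fin: "finite (pverts ?M)"
    by (simp add: mycielskian_def pair_finite_verts)
  have sub: "parcs ?M \<subseteq> pverts ?M \<times> pverts ?M"
    by (auto simp: mycielskian_def dest: in_arcsD1 in_arcsD2)
  have no_loops': "x \<noteq> y" if "(x, y) \<in> parcs G" for x y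
    using pair_no_loops[OF that] by simp
  have sy: "(y, x) \<in> parcs G" if "(x, y) \<in> parcs G" for x y
    using pair_sym_arcs that by (auto simp: symmetric_def sym_def)
  show ?thesis
  proof unfold_locales
    show "fst e \<in> pverts ?M" "snd e \<in> pverts ?M" if "e \<in> parcs ?M" for e
      using that sub by auto
    show "finite (pverts ?M)" by (fact fin)
    show "finite (parcs ?M)"
      using sub fin by (meson finite_SigmaI finite_subset)
    show "fst e \<noteq> snd e" if "e \<in> parcs ?M" for e
      using that no_loops' by (auto simp: mycielskian_def)
    show "symmetric (with_proj ?M)"
      unfolding symmetric_def with_proj_simps
      by (rule symI) (auto simp: mycielskian_def dest: sy)
  qed
qed

end

theory Submission
  imports Defs
begin

text \<open>
  Upper bound: extend a minimum function by 0 on the copies and 2 on the apex \<open>u\<close>.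
  Lower bound: let \<open>h\<close> be Roman dominating on the Mycielskian, and project it to
  \<open>g x = max (h x\<^sup>0) (h x\<^sup>1)\<close>, which is Roman dominating on \<open>G\<close> and has
  weight at most that of \<open>h\<close> minus \<open>h u\<close>. If \<open>h u = 2\<close> this suffices. If \<open>h u = 0\<close>, some copy
  \<open>z\<^sup>1\<close> has value 2, and \<open>g\<close> stays dominating when \<open>g z\<close> is replaced by \<open>h z\<^sup>0\<close>: a vertex
  \<open>w \<noteq> z\<close> with \<open>g w = 0\<close> has \<open>h w\<^sup>1 = 0\<close>, so it is dominated through some \<open>y\<^sup>0\<close>. This
  saves 2. If \<open>h u = 1\<close> and the bound fails, then \<open>g\<close> is a minimum function and each \<open>x\<close> has
  \<open>h x\<^sup>0 = 0\<close> or \<open>h x\<^sup>1 = 0\<close>. For \<open>v\<close> isolated in the 2-class of \<open>g\<close>, whichever of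
  \<open>v\<^sup>0\<close>, \<open>v\<^sup>1\<close> has value 0 is dominated by a vertex over a neighbour of \<open>v\<close> in that
  class, a contradiction.
\<close>

lemma rdf_weight_mycielskian:
  assumes "finite (pverts G)"
  shows "rdf_weight (mycielskian G) h = (\<Sum>x\<in>pverts G. h (Orig x) + h (Copy x)) + h Apex"
proof -
  have "rdf_weight (mycielskian G) h
      = sum h (Orig ` pverts G \<union> Copy ` pverts G) + sum h {Apex}"
    unfolding rdf_weight_def mycielskian_def pair_pre_digraph.simps
    by (rule sum.union_disjoint) (use assms in auto)
  also have "sum h (Orig ` pverts G \<union> Copy ` pverts G)
      = sum h (Orig ` pverts G) + sum h (Copy ` pverts G)"
    by (rule sum.union_disjoint) (use assms in auto)
  finally show ?thesis
    by (simp add: sum.reindex inj_on_def sum.distrib)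
qed

text \<open>Each clause reads off a neighbourhood: originals never see \<open>Apex\<close>, and
  copies never see copies. So a copy of value 0 needs a dominating original unless
  \<open>Apex\<close> itself has value 2.\<close>

lemma roman_dominating_mycielskianD:
  assumes "roman_dominating (mycielskian G) h"
  shows "x \<in> pverts G \<Longrightarrow> h (Orig x) \<in> {0, 1, 2}"
    and "x \<in> pverts G \<Longrightarrow> h (Copy x) \<in> {0, 1, 2}"
    and "h Apex \<in> {0, 1, 2}"
    and "x \<in> pverts G \<Longrightarrow> h (Orig x) = 0 \<Longrightarrow>
      \<exists>y\<in>pverts G. (x, y) \<in> parcs G \<and> (h (Orig y) = 2 \<or> h (Copy y) = 2)"
    and "x \<in> pverts G \<Longrightarrow> h (Copy x) = 0 \<Longrightarrow> h Apex \<noteq> 2 \<Longrightarrow>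
      \<exists>y\<in>pverts G. (x, y) \<in> parcs G \<and> h (Orig y) = 2"
    and "h Apex = 0 \<Longrightarrow> \<exists>z\<in>pverts G. h (Copy z) = 2"
proof -
  let ?M = "mycielskian G"
  have val: "h v \<in> {0, 1, 2}" if "v \<in> pverts ?M" for v
    using assms that by (auto simp: roman_dominating_def)
  have dom: "\<exists>w\<in>pverts ?M. (v, w) \<in> parcs ?M \<and> h w = 2" if "v \<in> pverts ?M" "h v = 0" for v
    using assms that by (auto simp: roman_dominating_def)
  show "h (Orig x) \<in> {0, 1, 2}" if "x \<in> pverts G"
    by (rule val) (use that in \<open>auto simp: mycielskian_def\<close>)
  show "h (Copy x) \<in> {0, 1, 2}" if "x \<in> pverts G"
    by (rule val) (use that in \<open>auto simp: mycielskian_def\<close>)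
  show "h Apex \<in> {0, 1, 2}"
    by (rule val) (auto simp: mycielskian_def)
  show "\<exists>y\<in>pverts G. (x, y) \<in> parcs G \<and> (h (Orig y) = 2 \<or> h (Copy y) = 2)"
    if "x \<in> pverts G" "h (Orig x) = 0"
    using dom[of "Orig x"] that by (auto simp: mycielskian_def)
  show "\<exists>y\<in>pverts G. (x, y) \<in> parcs G \<and> h (Orig y) = 2"
    if "x \<in> pverts G" "h (Copy x) = 0" "h Apex \<noteq> 2"
    using dom[of "Copy x"] that by (auto simp: mycielskian_def)
  show "\<exists>z\<in>pverts G. h (Copy z) = 2" if "h Apex = 0"
    using dom[of Apex] that by (auto simp: mycielskian_def)
qed

lemma roman_domination_number_mycielskian_le:
  assumes "pair_graph G"
  shows "roman_domination_number (mycielskian G) \<le> roman_domination_number G + 2"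
proof -
  interpret pair_graph G by (fact assms)
  obtain f where f: "roman_dominating G f" "rdf_weight G f = roman_domination_number G"
    using roman_domination_number_attained by blast
  define h where "h = case_mycielski_vertex f (\<lambda>_. 0) (2::nat)"
  \<comment> \<open>Originals keep their dominators from \<open>G\<close>, and every copy is
    adjacent to \<open>Apex\<close>.\<close>
  have "roman_dominating (mycielskian G) h"
    using f(1) by (fastforce simp: roman_dominating_def mycielskian_def h_def)
  moreover have "rdf_weight (mycielskian G) h = rdf_weight G f + 2"
    by (simp add: rdf_weight_mycielskian pair_finite_verts h_def)
      (simp add: rdf_weight_def)
  ultimately show ?thesis
    using roman_domination_number_le f(2) by metis
qed

text \<open>Unlike the sum, the maximum of two values in {0, 1, 2} stays in that range; it falls
  short of the sum exactly when both are positive.\<close>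

definition mycielski_projection :: "('a mycielski_vertex \<Rightarrow> nat) \<Rightarrow> 'a \<Rightarrow> nat" where
  "mycielski_projection h x = max (h (Orig x)) (h (Copy x))"

text \<open>A projected value 0 forces \<open>h (Orig x) = 0\<close>, and the dominator of
  \<open>Orig x\<close> lies over a neighbour of \<open>x\<close>, where the maximum is 2.\<close>

lemma roman_dominating_projection:
  assumes "roman_dominating (mycielskian G) h"
  shows "roman_dominating G (mycielski_projection h)"
proof -
  note D = roman_dominating_mycielskianD[OF assms]
  have val: "mycielski_projection h x \<in> {0, 1, 2}" if "x \<in> pverts G" for x
    using D(1,2)[OF that] by (auto simp: mycielski_projection_def)
  have eq2: "mycielski_projection h y = 2"
    if "y \<in> pverts G" "h (Orig y) = 2 \<or> h (Copy y) = 2" for y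
    using D(1,2)[OF that(1)] that(2) by (auto simp: mycielski_projection_def)
  have "\<exists>y\<in>pverts G. (x, y) \<in> parcs G \<and> mycielski_projection h y = 2"
    if x: "x \<in> pverts G" "mycielski_projection h x = 0" for x
  proof -
    have "h (Orig x) = 0" using x(2) by (simp add: mycielski_projection_def)
    from D(4)[OF x(1) this] eq2 show ?thesis by blast
  qed
  with val show ?thesis by (auto simp: roman_dominating_def)
qed

lemma rdf_weight_projection_le:
  "rdf_weight G (mycielski_projection h) \<le> (\<Sum>x\<in>pverts G. h (Orig x) + h (Copy x))"
  unfolding rdf_weight_def mycielski_projection_def by (rule sum_mono) simp

lemma roman_dominating_projection_update:
  assumes "pair_graph G" and h: "roman_dominating (mycielskian G) h"
    and apex: "h Apex \<noteq> 2"
  shows "roman_dominating G ((mycielski_projection h)(z := h (Orig z)))"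
    (is "roman_dominating G ?g")
proof -
  interpret pair_graph G by (fact assms(1))
  note D = roman_dominating_mycielskianD[OF h]
  have val: "?g x \<in> {0, 1, 2}" if "x \<in> pverts G" for x
    using D(1,2)[OF that] by (auto simp: mycielski_projection_def)
  have eq2: "?g y = 2"
    if "y \<in> pverts G" "h (Orig y) = 2 \<or> y \<noteq> z \<and> h (Copy y) = 2" for y
    using D(1,2)[OF that(1)] that(2) by (auto simp: mycielski_projection_def)
  have "\<exists>y\<in>pverts G. (x, y) \<in> parcs G \<and> ?g y = 2"
    if x: "x \<in> pverts G" "?g x = 0" for x
  proof (cases "x = z")
    case True
    with x obtain y where y: "y \<in> pverts G" "(x, y) \<in> parcs G" "h (Orig y) = 2 \<or> h (Copy y) = 2"
      using D(4)[of x] by auto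
    \<comment> \<open>Without loops the dominator lies over a vertex other than \<open>z\<close>, so
      the update does not affect it.\<close>
    then have "y \<noteq> z" using True pair_no_loops by fastforce
    with y eq2 show ?thesis by blast
  next
    case False
    then have "h (Copy x) = 0" using x(2) by (simp add: mycielski_projection_def)
    from D(5)[OF x(1) this apex] eq2 show ?thesis by blast
  qed
  with val show ?thesis unfolding roman_dominating_def by blast
qed

lemma rdf_weight_ge_if_apex_0:
  assumes "pair_graph G" and h: "roman_dominating (mycielskian G) h" and apex: "h Apex = 0"
  shows "roman_domination_number G + 2 \<le> rdf_weight (mycielskian G) h"
proof -
  interpret pair_graph G by (fact assms(1))
  obtain z where z: "z \<in> pverts G" "h (Copy z) = 2"
    using roman_dominating_mycielskianD(6)[OF h apex] by blast
  let ?g = "(mycielski_projection h)(z := h (Orig z))"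
  have "roman_domination_number G \<le> rdf_weight G ?g"
    by (intro roman_domination_number_le roman_dominating_projection_update)
      (use assms in auto)
  \<comment> \<open>Putting the saved 2 back at \<open>z\<close> makes the comparison termwise: at
    \<open>z\<close> it replaces \<open>h (Copy z)\<close>.\<close>
  also have "rdf_weight G ?g + 2 = (\<Sum>x\<in>pverts G. ?g x + (if x = z then 2 else 0))"
    using z(1) by (simp add: rdf_weight_def sum.distrib pair_finite_verts)
  then have "rdf_weight G ?g + 2 \<le> (\<Sum>x\<in>pverts G. h (Orig x) + h (Copy x))"
    using z(2) by (auto simp: mycielski_projection_def intro!: sum_mono)
  finally show ?thesis
    using apex by (simp add: rdf_weight_mycielskian pair_finite_verts)
qed

lemma isolated_vertex_rdf_classD:
  assumes "isolated_vertex (with_proj G \<restriction> rdf_class G f i) v"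
  shows "v \<in> pverts G" "f v = i"
    and "y \<in> pverts G \<Longrightarrow> (v, y) \<in> parcs G \<Longrightarrow> f y \<noteq> i"
proof -
  let ?H = "with_proj G \<restriction> rdf_class G f i"
  show v: "v \<in> pverts G" "f v = i"
    using assms by (auto simp: isolated_vertex_def rdf_class_def)
  show "f y \<noteq> i" if "y \<in> pverts G" "(v, y) \<in> parcs G"
  proof
    assume "f y = i"
    with that v have "(v, y) \<in> out_arcs ?H v"
      by (simp add: out_arcs_def induce_subgraph_def rdf_class_def)
    with assms show False by (simp add: isolated_vertex_def)
  qed
qed

lemma rdf_weight_ge_if_apex_1:
  assumes "pair_graph G" and h: "roman_dominating (mycielskian G) h" and apex: "h Apex = 1"
    and isolated: "\<And>f. roman_min_function G f \<Longrightarrow>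
      \<exists>v. isolated_vertex (with_proj G \<restriction> rdf_class G f 2) v"
  shows "roman_domination_number G + 2 \<le> rdf_weight (mycielskian G) h"
proof (rule ccontr)
  interpret pair_graph G by (fact assms(1))
  note D = roman_dominating_mycielskianD[OF h]
  let ?g = "mycielski_projection h"
  assume "\<not> ?thesis"
  then have "(\<Sum>x\<in>pverts G. h (Orig x) + h (Copy x)) \<le> roman_domination_number G"
    using apex by (simp add: rdf_weight_mycielskian pair_finite_verts)
  moreover have "roman_domination_number G \<le> rdf_weight G ?g"
    by (intro roman_domination_number_le roman_dominating_projection h)
  \<comment> \<open>The weight of the projection is squeezed between two bounds that coincide, so
    both inequalities are equalities.\<close>
  ultimately have min: "roman_min_function G ?g"
    and weight: "rdf_weight G ?g = (\<Sum>x\<in>pverts G. h (Orig x) + h (Copy x))"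
    using rdf_weight_projection_le[of G h] roman_dominating_projection[OF h]
    by (auto simp: roman_min_function_def)
  obtain v where "isolated_vertex (with_proj G \<restriction> rdf_class G ?g 2) v"
    using isolated[OF min] by blast
  note v = isolated_vertex_rdf_classD[OF this]
  \<comment> \<open>Equal sums with termwise inequality agree at every vertex.\<close>
  have "?g v = h (Orig v) + h (Copy v)"
    using weight unfolding rdf_weight_def
    by (rule sum_mono_inv) (use v(1) in \<open>auto simp: mycielski_projection_def pair_finite_verts\<close>)
  then have "h (Orig v) = 0 \<or> h (Copy v) = 0"
    by (auto simp: mycielski_projection_def max_def split: if_splits)
  \<comment> \<open>\<open>Apex\<close> has value 1, so it cannot dominate
    \<open>Copy v\<close>.\<close>
  then obtain y where y: "y \<in> pverts G" "(v, y) \<in> parcs G" "h (Orig y) = 2 \<or> h (Copy y) = 2"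
    using D(4,5)[OF v(1)] apex by fastforce
  then have "?g y = 2"
    using D(1,2)[OF y(1)] by (auto simp: mycielski_projection_def)
  with v(3)[OF y(1,2)] show False by blast
qed

theorem theorem4:
  fixes G :: "'a pair_pre_digraph"
  assumes "pair_graph G"
    and "\<And>f. roman_min_function G f \<Longrightarrow>
           \<exists>v. isolated_vertex (with_proj G \<restriction> rdf_class G f 2) v"
  shows "roman_domination_number (mycielskian G) = roman_domination_number G + 2"
proof (rule antisym)
  interpret pair_graph G by (fact assms(1))
  show "roman_domination_number (mycielskian G) \<le> roman_domination_number G + 2"
    by (rule roman_domination_number_mycielskian_le) (fact assms(1))
  obtain h where h: "roman_dominating (mycielskian G) h"
    and weight: "rdf_weight (mycielskian G) h = roman_domination_number (mycielskian G)"
    using roman_domination_number_attained by blast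
  consider "h Apex = 0" | "h Apex = 1" | "h Apex = 2"
    using roman_dominating_mycielskianD(3)[OF h] by auto
  then have "roman_domination_number G + 2 \<le> rdf_weight (mycielskian G) h"
  proof cases
    case 1
    with assms(1) h show ?thesis by (rule rdf_weight_ge_if_apex_0)
  next
    case 2
    with assms(1) h show ?thesis by (rule rdf_weight_ge_if_apex_1) (fact assms(2))
  next
    case 3
    have "roman_domination_number G \<le> rdf_weight G (mycielski_projection h)"
      by (intro roman_domination_number_le roman_dominating_projection h)
    with 3 rdf_weight_projection_le[of G h] show ?thesis
      by (simp add: rdf_weight_mycielskian pair_finite_verts)
  qed
  with weight show "roman_domination_number G + 2 \<le> roman_domination_number (mycielskian G)"
    by simp
qed

end
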